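(* The set of matrices $\{I_{12},-D_0,F_U\}$, where $$I_{12}=\begin{pmatrix}-1&1&0&0&0\\0&1&0&0&0\\0&0&1&0&0\\0&0&0&1&0\\0&0&0&0&1\end{pmatrix},\quad -D_0=\begin{pmatrix}0&0&0&0&1\\0&0&0&1&0\\0&0&1&0&0\\0&1&0&0&0\\1&0&0&0&0\end{pmatrix},\quad F_U=\begin{pmatrix}0&0&0&1&0\\0&0&1&0&0\\0&1&0&0&0\\1&0&0&0&0\\0&0&0&0&1\end{pmatrix},$$ generates the whole group $ESL_5(\mathbb{Z})$.
   Context: $ESL_5(\mathbb{Z})$ denotes the group of all $5\times5$ integer matrices with determinant $1$ or $-1$. *)

theory Defs
  imports "HOL-Analysis.Analysis" "HOL-Algebra.Generated_Groups"
begin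

definition ESL :: "(int^'n^'n) monoid" where
  "ESL = \<lparr>carrier = {A. det A = 1 \<or> det A = -1}, mult = (\<lambda>A B. A ** B), one = mat 1\<rparr>"

lemma ESL_simps [simp]:
  "carrier ESL = {A :: int^'n^'n. det A = 1 \<or> det A = -1}"
  "A \<otimes>\<^bsub>ESL\<^esub> B = A ** B"
  "\<one>\<^bsub>ESL\<^esub> = (mat 1 :: int^'n^'n)"
  by (simp_all add: ESL_def)

lemma ESL_right_inverse:
  fixes A :: "int^'n^'n"
  assumes "det A = 1 \<or> det A = -1"
  shows "\<exists>R. A ** R = mat 1 \<and> (det R = 1 \<or> det R = -1)"
proof -
  \<comment> \<open>\<open>R\<close> is \<open>det A\<close> times the adjugate of \<open>A\<close>.\<close>
  define B :: "int^'n^'n" where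
    "B = (\<chi> i j. det (\<chi> k. if k = j then axis i 1 else A $ k))"
  define R :: "int^'n^'n" where "R = (\<chi> i j. det A * B $ i $ j)"
  have key: "(\<Sum>i\<in>UNIV. A $ k $ i * B $ i $ j) = (if k = j then det A else 0)" for k j
  proof -
    have row: "A $ k = (\<Sum>i\<in>UNIV. A $ k $ i *s axis i 1)"
      by (simp add: vec_eq_iff axis_def if_distrib [of "(*) _"] cong: if_cong)
    have "(\<Sum>i\<in>UNIV. A $ k $ i * B $ i $ j)
        = det (\<chi> l. if l = j then (\<Sum>i\<in>UNIV. A $ k $ i *s axis i 1) else A $ l)"
      by (simp add: B_def det_linear_row_sum det_row_mul)
    also have "\<dots> = det (\<chi> l. if l = j then A $ k else A $ l)"
      by (simp only: row [symmetric])
    also have "\<dots> = (if k = j then det A else 0)"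
    proof (cases "k = j")
      case True
      have "(\<chi> l. if l = j then A $ k else A $ l) = A"
        using True by (simp add: vec_eq_iff)
      with True show ?thesis by simp
    next
      case False
      have "det (\<chi> l. if l = j then A $ k else A $ l) = 0"
        by (rule det_identical_rows [OF False]) (use False in \<open>simp add: row_def\<close>)
      with False show ?thesis by simp
    qed
    finally show ?thesis .
  qed
  have "det A * det A = 1"
    using assms by auto
  moreover have "(\<Sum>i\<in>UNIV. A $ k $ i * (det A * B $ i $ j))
      = det A * (\<Sum>i\<in>UNIV. A $ k $ i * B $ i $ j)" for k j
    by (simp add: sum_distrib_left mult.left_commute)
  ultimately have AR: "A ** R = mat 1"
    by (simp add: R_def vec_eq_iff matrix_matrix_mult_def mat_def key)
  then have "det A * det R = 1"
    by (metis det_mul det_I)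
  then have "det R = 1 \<or> det R = -1"
    using assms by auto
  with AR show ?thesis by blast
qed

lemma group_ESL: "group (ESL :: (int^'n^'n) monoid)"
proof (rule groupI)
  fix A :: "int^'n^'n"
  assume A: "A \<in> carrier ESL"
  then obtain R where R: "A ** R = mat 1" "det R = 1 \<or> det R = -1"
    using ESL_right_inverse by auto
  then obtain C where C: "R ** C = mat 1"
    using ESL_right_inverse by blast
  have "A = A ** (R ** C)"
    by (simp add: C)
  also have "\<dots> = C"
    by (simp add: matrix_mul_assoc R)
  finally have "R ** A = mat 1"
    using C by simp
  with R show "\<exists>B\<in>carrier ESL. B \<otimes>\<^bsub>ESL\<^esub> A = \<one>\<^bsub>ESL\<^esub>"
    by auto
qed (auto simp: det_mul matrix_mul_assoc)

text \<open>\<^const>\<open>vector\<close> numbers the entries of a list \<open>1, 2, 3, 4, 5\<close>; in the index type \<open>5\<close>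
  the last of these indices is \<open>5 = 0\<close>.\<close>

lemma vector_5 [simp]:
  "(vector [a, b, c, d, e] :: ('a::zero)^5) $ 1 = a"
  "(vector [a, b, c, d, e] :: ('a::zero)^5) $ 2 = b"
  "(vector [a, b, c, d, e] :: ('a::zero)^5) $ 3 = c"
  "(vector [a, b, c, d, e] :: ('a::zero)^5) $ 4 = d"
  "(vector [a, b, c, d, e] :: ('a::zero)^5) $ 5 = e"
  by (simp_all add: vector_def)

definition I\<^sub>1\<^sub>2 :: "int^5^5" where
  "I\<^sub>1\<^sub>2 = vector
    [vector [-1, 1, 0, 0, 0],
     vector [ 0, 1, 0, 0, 0],
     vector [ 0, 0, 1, 0, 0],
     vector [ 0, 0, 0, 1, 0],
     vector [ 0, 0, 0, 0, 1]]"

definition minus_D\<^sub>0 :: "int^5^5" where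
  "minus_D\<^sub>0 = vector
    [vector [0, 0, 0, 0, 1],
     vector [0, 0, 0, 1, 0],
     vector [0, 0, 1, 0, 0],
     vector [0, 1, 0, 0, 0],
     vector [1, 0, 0, 0, 0]]"

definition F\<^sub>U :: "int^5^5" where
  "F\<^sub>U = vector
    [vector [0, 0, 0, 1, 0],
     vector [0, 0, 1, 0, 0],
     vector [0, 1, 0, 0, 0],
     vector [1, 0, 0, 0, 0],
     vector [0, 0, 0, 0, 1]]"

end

theory Submission
  imports Defs
begin

text \<open>The dihedral group generated by \<open>-D\<^sub>0\<close> and \<open>F\<^sub>U\<close> acts on the five indices, read modulo 5,
  by \<open>r \<mapsto> 1 - r\<close> and \<open>r \<mapsto> -r\<close>. Conjugating \<open>I\<^sub>1\<^sub>2\<close> by it yields every operation that replaces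
  row \<open>i\<close> by its difference from a cyclically adjacent row \<open>j\<close>. An explicit word of length ten in
  these operations adds row \<open>i + 2\<close> to row \<open>i\<close>; from it all elementary matrices and all sign
  changes arise, and Euclidean row reduction finishes the proof.\<close>

section \<open>Row operations as left multiplications\<close>

definition transv :: "'n \<Rightarrow> 'n \<Rightarrow> int \<Rightarrow> int^'n^'n" where
  "transv i j c = (\<chi> r s. (if r = s then 1 else 0) + (if r = i \<and> s = j then c else 0))"

definition negate :: "'n \<Rightarrow> int^'n^'n" where
  "negate i = (\<chi> r s. if r = s then if r = i then -1 else 1 else 0)"

text \<open>For \<open>i \<noteq> j\<close> this is an involution of determinant -1;
  \<open>I\<^sub>1\<^sub>2\<close> is the instance with indices 1 and 2.\<close>

definition refl_to :: "'n \<Rightarrow> 'n \<Rightarrow> int^'n^'n" where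
  "refl_to i j = transv i j 1 ** negate i"

lemma transv_mult:
  "transv i j c ** A = (\<chi> r. if r = i then A $ i + c *s A $ j else A $ r)"
  by (auto simp: transv_def vec_eq_iff matrix_matrix_mult_def distrib_right sum.distrib
      if_distrib [of "\<lambda>x. x * _"] cong: if_cong)

lemma negate_mult:
  "negate i ** A = (\<chi> r. if r = i then - A $ i else A $ r)"
  by (auto simp: negate_def vec_eq_iff matrix_matrix_mult_def
      if_distrib [of "\<lambda>x. x * _"] sum_negf cong: if_cong)

lemma refl_to_mult:
  assumes "i \<noteq> j"
  shows "refl_to i j ** A = (\<chi> r. if r = i then A $ j - A $ i else A $ r)"
proof -
  have "refl_to i j ** A = transv i j 1 ** (negate i ** A)"
    by (simp add: refl_to_def matrix_mul_assoc)
  then show ?thesis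
    using assms by (simp add: transv_mult negate_mult vec_eq_iff)
qed

text \<open>The word was found by computer search. It uses only adjacent pairs of the 5-cycle
  \<open>a, b, c, d, e\<close>.\<close>

lemma transv_word:
  assumes "a \<noteq> b" "a \<noteq> c" "a \<noteq> d" "a \<noteq> e" "b \<noteq> c" "b \<noteq> d" "b \<noteq> e" "c \<noteq> d" "c \<noteq> e" "d \<noteq> e"
  shows "transv a c 1 ** A = refl_to a e ** (refl_to a b ** (refl_to c d ** (refl_to b c **
    (refl_to e d ** (refl_to a e ** (refl_to e d ** (refl_to a b ** (refl_to b c **
      (refl_to c d ** A)))))))))"
  using assms by (simp add: refl_to_mult transv_mult vec_eq_iff)

text \<open>Conjugating by the involution \<open>refl_to j k\<close> turns adding row
  \<open>j\<close> into adding row \<open>k\<close> minus row \<open>j\<close>; the other addition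
  of row \<open>j\<close> cancels the unwanted part.\<close>

lemma transv_trans:
  assumes "i \<noteq> j" "j \<noteq> k" "i \<noteq> k"
  shows "transv i k 1 ** A = refl_to j k ** (transv i j 1 ** (refl_to j k ** (transv i j 1 ** A)))"
  using assms by (simp add: refl_to_mult transv_mult vec_eq_iff)

lemma negate_eq:
  assumes "i \<noteq> j"
  shows "negate i ** A = refl_to i j ** (transv i j 1 ** A)"
  using assms by (simp add: refl_to_mult transv_mult negate_mult vec_eq_iff)

section \<open>Row reduction of integer matrices with determinant 1 or -1\<close>

lemma row_clear:
  fixes A :: "int^'n^'n"
  assumes "finite F" "i \<notin> F"
    and add: "\<And>A i j c. i \<noteq> j \<Longrightarrow> P (transv i j c ** A) \<Longrightarrow> P A"
    and "P (\<chi> r. if r \<in> F then A $ r + f r *s A $ i else A $ r)"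
  shows "P A"
  using assms(1,2,4)
proof (induction F arbitrary: A rule: finite_induct)
  case empty
  then show ?case by (simp add: vec_lambda_eta)
next
  case (insert x F)
  \<comment> \<open>Row \<open>i\<close> lies outside the set, so changing row \<open>x\<close>
    leaves it intact and the additions do not interfere.\<close>
  have "(\<chi> r. if r \<in> insert x F then A $ r + f r *s A $ i else A $ r)
    = (\<chi> r. if r \<in> F then (transv x i (f x) ** A) $ r + f r *s (transv x i (f x) ** A) $ i
             else (transv x i (f x) ** A) $ r)"
    using insert.hyps(2) insert.prems(1) by (auto simp: vec_eq_iff transv_mult)
  then have "P (transv x i (f x) ** A)"
    using insert.IH [of "transv x i (f x) ** A"] insert.prems by simp
  then show ?case
    using add [of x i] insert.prems(1) by blast
qed

text \<open>The columns are turned into those of the identity one at a time: the Euclidean algorithm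
  leaves a single unit among the unfinished rows, and this pivot clears its column.\<close>

lemma unimodular_row_induct [consumes 1, case_names id add neg]:
  fixes A :: "int^'n^'n"
  assumes "det A = 1 \<or> det A = -1"
    and id: "P (mat 1)"
    and add: "\<And>A i j c. i \<noteq> j \<Longrightarrow> P (transv i j c ** A) \<Longrightarrow> P A"
    and neg: "\<And>A i. P (negate i ** A) \<Longrightarrow> P A"
  shows "P A"
proof -
  have row_eq: "row i A = A $ i" for i and A :: "int^'n^'n"
    by (simp add: row_def vec_lambda_eta)
  have det_transv: "det (transv i j c ** A) = det A" if "i \<noteq> j" for i j c and A :: "int^'n^'n"
    using det_row_operation [OF that, of A c] by (simp only: transv_mult row_eq)
  have det_negate: "det (negate i ** A) = - det A" for i and A :: "int^'n^'n"
  proof -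
    have "negate i ** A = (\<chi> r. if r = i then -1 *s A $ r else A $ r)"
      by (simp add: negate_mult vec_eq_iff)
    then show ?thesis
      using det_row_mul [of i "-1" "\<lambda>r. A $ r" "\<lambda>r. A $ r"] by (simp add: vec_lambda_eta)
  qed
  define fixed :: "'n set \<Rightarrow> int^'n^'n \<Rightarrow> bool"
    where "fixed S A \<longleftrightarrow> (\<forall>k\<in>S. \<forall>r. A $ r $ k = (if r = k then 1 else 0))" for S A
  \<comment> \<open>For \<open>j \<notin> S\<close>, row \<open>j\<close> is zero in the columns
    from \<open>S\<close>, so using it as a source keeps these columns.\<close>
  have fixed_transv: "fixed S (transv i j c ** A)" if "fixed S A" "j \<notin> S" for S i j c A
    using that by (auto simp: fixed_def transv_mult)
  have fixed_negate: "fixed S (negate i ** A)" if "fixed S A" "i \<notin> S" for S i A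
    using that by (auto simp: fixed_def negate_mult)
  have step: "P A"
    if "det A = 1 \<or> det A = -1" "fixed S A" "k \<notin> S"
      and fix_k: "\<And>A. det A = 1 \<or> det A = -1 \<Longrightarrow> fixed (insert k S) A \<Longrightarrow> P A"
    for S k and A :: "int^'n^'n"
    using that(1,2)
  \<comment> \<open>Only rows outside \<open>S\<close> may serve as sources, so the Euclidean
    algorithm on column \<open>k\<close> runs among these rows.\<close>
  proof (induction "\<Sum>i\<in>-S. nat \<bar>A $ i $ k\<bar>" arbitrary: A rule: less_induct)
    case less
    then obtain R where R: "R ** A = mat 1"
      using group.l_inv_ex [OF group_ESL] by (metis (mono_tags) CollectI ESL_simps)
    \<comment> \<open>A Bezout relation: as the columns in \<open>S\<close> are unit vectors, row
      \<open>k\<close> of the inverse vanishes there, so the entries of column \<open>k\<close>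
      outside \<open>S\<close> are coprime.\<close>
    have Rk: "(\<Sum>i\<in>-S. R $ k $ i * A $ i $ k) = 1"
    proof -
      have R0: "R $ k $ i = 0" if "i \<in> S" for i
      proof -
        have "0 = (R ** A) $ k $ i" using R that \<open>k \<notin> S\<close> by (auto simp: mat_def)
        also have "\<dots> = R $ k $ i"
          using that less.prems(2)
          by (simp add: matrix_matrix_mult_def fixed_def if_distrib [of "\<lambda>x. _ * x"] cong: if_cong)
        finally show ?thesis by simp
      qed
      have "1 = (R ** A) $ k $ k" using R by (simp add: mat_def)
      also have "\<dots> = (\<Sum>i\<in>UNIV. R $ k $ i * A $ i $ k)" by (simp add: matrix_matrix_mult_def)
      also have "\<dots> = (\<Sum>i\<in>-S. R $ k $ i * A $ i $ k)"
        by (rule sum.mono_neutral_right) (auto simp: R0)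
      finally show ?thesis by simp
    qed
    then obtain i where i: "i \<notin> S" "A $ i $ k \<noteq> 0"
      by (metis (no_types, lifting) ComplD mult_eq_0_iff sum.neutral zero_neq_one)
    show ?case
    proof (cases "\<exists>j. j \<notin> S \<and> j \<noteq> i \<and> A $ j $ k \<noteq> 0")
      case True
      then obtain j where j: "j \<notin> S" "j \<noteq> i" "A $ j $ k \<noteq> 0" by blast
      obtain i' j' where ij: "i' \<notin> S" "j' \<notin> S" "i' \<noteq> j'" "A $ j' $ k \<noteq> 0" "\<bar>A $ j' $ k\<bar> \<le> \<bar>A $ i' $ k\<bar>"
        using i j by (metis linorder_le_cases)
      \<comment> \<open>These signs subtract the smaller absolute value from the larger one: a
        subtractive Euclidean step.\<close>
      define c where "c = - sgn (A $ i' $ k) * sgn (A $ j' $ k)"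
      have less': "\<bar>A $ i' $ k + c * A $ j' $ k\<bar> < \<bar>A $ i' $ k\<bar>"
        using ij by (auto simp: c_def sgn_if abs_if split: if_splits)
      show ?thesis
      proof (rule add [of i' j' c], fact, rule less.hyps)
        show "(\<Sum>r\<in>-S. nat \<bar>(transv i' j' c ** A) $ r $ k\<bar>) < (\<Sum>r\<in>-S. nat \<bar>A $ r $ k\<bar>)"
          by (rule sum_strict_mono_ex1) (use ij less' in \<open>auto simp: transv_mult intro!: bexI [of _ i']\<close>)
      qed (use less.prems ij in \<open>simp_all add: det_transv fixed_transv\<close>)
    next
      case False
      \<comment> \<open>With one nonzero entry left, the Bezout relation has a single term, so this
        entry is a unit.\<close>
      have "(\<Sum>r\<in>-S. R $ k $ r * A $ r $ k) = R $ k $ i * A $ i $ k"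
        by (subst sum.mono_neutral_right [of _ "{i}"]) (use False i in auto)
      then have unit: "\<bar>A $ i $ k\<bar> = 1"
        using Rk by (metis abs_zmult_eq_1 mult.commute abs_one)
      have unit_case: "P A" if A: "det A = 1 \<or> det A = -1" "fixed S A" "A $ i $ k = 1" for A
      proof -
        \<comment> \<open>Pivot row \<open>i\<close> clears column \<open>k\<close> but leaves 1 in
          row \<open>k\<close>; if \<open>i \<noteq> k\<close>, subtracting row \<open>k\<close>
          from row \<open>i\<close> then moves the pivot to the diagonal.\<close>
        define B where "B = (\<chi> r. if r \<in> -{i}
          then A $ r + ((if r = k then 1 else 0) - A $ r $ k) *s A $ i else A $ r)"
        \<comment> \<open>Here \<open>row_clear\<close> is applied to a property of the determinant,
          which row additions preserve.\<close>
        have "det A = det B"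
          by (rule row_clear [of "-{i}" i "\<lambda>M. det M = det B" A
                "\<lambda>r. (if r = k then 1 else 0) - A $ r $ k"])
            (simp_all add: det_transv B_def)
        with A have detB: "det B = 1 \<or> det B = -1" by simp
        have fixedB: "fixed S B"
          using A(2) i(1) by (auto simp: fixed_def B_def)
        have Bk: "B $ r $ k = (if r = k \<or> r = i then 1 else 0)" for r
          using A(3) by (auto simp: B_def)
        have "P B"
        proof (cases "i = k")
          case True
          then have "fixed (insert k S) B"
            using fixedB Bk by (simp add: fixed_def)
          with detB show ?thesis by (rule fix_k)
        next
          case False
          then have "fixed (insert k S) (transv i k (-1) ** B)"
            using fixed_transv [OF fixedB \<open>k \<notin> S\<close>, of i "-1"] Bk
            by (simp add: fixed_def transv_mult)
          with detB show ?thesis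
            using fix_k add [OF False, of "-1" B] det_transv [OF False, of "-1" B] by simp
        qed
        show ?thesis
        proof (rule row_clear [of "-{i}" i P A])
          show "P (\<chi> r. if r \<in> -{i}
            then A $ r + ((if r = k then 1 else 0) - A $ r $ k) *s A $ i else A $ r)"
            using \<open>P B\<close> unfolding B_def .
        qed (simp, simp, rule add)
      qed
      show ?thesis
      proof (cases "A $ i $ k = 1")
        case True with less.prems unit_case show ?thesis by blast
      next
        case False
        with unit have "A $ i $ k = -1" by auto
        then show ?thesis
          using neg [of i A] unit_case [of "negate i ** A"] less.prems i
          by (auto simp: det_negate fixed_negate) (simp_all add: negate_mult)
      qed
    qed
  qed
  have "P A" if "det A = 1 \<or> det A = -1" "fixed S A" for A S
    using that
  proof (induction "card (- S)" arbitrary: S A)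
    case 0
    then have "S = UNIV" by auto
    with 0 have "A = mat 1" by (simp add: fixed_def vec_eq_iff mat_def)
    with id show ?case by simp
  next
    case (Suc n)
    then obtain k where k: "k \<notin> S" by (metis Compl_iff card.empty ex_in_conv nat.distinct(1))
    have "card (- insert k S) = n"
      using Suc.hyps(2) k by (simp add: Compl_insert)
    then show ?case
      using step [OF Suc.prems k] Suc.hyps(1) by blast
  qed
  from this [of A "{}"] assms(1) show ?thesis by (simp add: fixed_def)
qed

section \<open>Index arithmetic modulo 5 and the three generators\<close>

lemma exhaust_5:
  fixes x :: 5
  shows "x = 1 \<or> x = 2 \<or> x = 3 \<or> x = 4 \<or> x = 5"
proof (induct x)
  case (of_int z)
  then have "z = 0 \<or> z = 1 \<or> z = 2 \<or> z = 3 \<or> z = 4" by fastforce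
  then show ?case by auto
qed

lemma forall_5: "(\<forall>i::5. P i) \<longleftrightarrow> P 1 \<and> P 2 \<and> P 3 \<and> P 4 \<and> P 5"
  by (metis exhaust_5)

lemma I\<^sub>1\<^sub>2_eq: "I\<^sub>1\<^sub>2 = refl_to 1 2"
proof -
  \<comment> \<open>The factor \<open>mat 1\<close> makes the row-operation rules applicable,
    provided it is not simplified away.\<close>
  have "refl_to 1 2 ** mat 1 = I\<^sub>1\<^sub>2"
    by (simp add: refl_to_mult vec_eq_iff forall_5 mat_def I\<^sub>1\<^sub>2_def del: matrix_mul_rid)
  then show ?thesis by simp
qed

lemma minus_D\<^sub>0_eq: "minus_D\<^sub>0 = (\<chi> r s. if s = 1 - r then 1 else 0)"
  by (simp add: minus_D\<^sub>0_def vec_eq_iff forall_5)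

lemma F\<^sub>U_eq: "F\<^sub>U = (\<chi> r s. if s = - r then 1 else 0)"
  by (simp add: F\<^sub>U_def vec_eq_iff forall_5)

lemma perm_mult:
  "(\<chi> r s. if s = q r then 1 else 0) ** (A :: int^'m^'n) = (\<chi> r. A $ q r)"
  by (simp add: vec_eq_iff matrix_matrix_mult_def if_distrib [of "\<lambda>x. x * _"] cong: if_cong)

text \<open>\<open>M\<close> is the permutation matrix of an involution, hence its own inverse; the
  product is a conjugation, which relabels the indices.\<close>

lemma refl_to_conj:
  fixes q :: "'n::finite \<Rightarrow> 'n"
  assumes q: "\<And>r. q (q r) = r"
  defines "M \<equiv> (\<chi> r s. if s = q r then 1 else 0)"
  shows "refl_to (q i) (q j) = M ** refl_to i j ** M"
proof -
  have q_eq: "r = q s \<longleftrightarrow> q r = s" for r s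
    using q by auto
  have left: "(M ** A) $ r $ s = A $ q r $ s" for A r s
    by (simp add: M_def perm_mult)
  have right: "(A ** M) $ r $ s = A $ r $ q s" for A r s
    by (simp add: M_def matrix_matrix_mult_def q_eq [of s] eq_commute [of "q s"]
        if_distrib [of "\<lambda>x. _ * x"] cong: if_cong)
  have "refl_to i j $ r $ s = negate i $ r $ s + (if r = i then negate i $ j $ s else 0)" for i j r s :: 'n
    by (simp add: refl_to_def transv_mult)
  then show ?thesis
    using q by (auto simp: vec_eq_iff left right negate_def q_eq)
qed

section \<open>The subgroup generated by the three matrices\<close>

lemma generate_mult:
  assumes "A \<in> generate ESL G" "B \<in> generate ESL G"
  shows "A ** B \<in> generate ESL G"
  using generate.eng [OF assms] by simp

theorem corollary2:
  shows "generate (ESL :: (int^5^5) monoid) {I\<^sub>1\<^sub>2, minus_D\<^sub>0, F\<^sub>U} = carrier ESL"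
proof -
  define H where "H = generate (ESL :: (int^5^5) monoid) {I\<^sub>1\<^sub>2, minus_D\<^sub>0, F\<^sub>U}"
  have mult: "A ** B \<in> H" if "A \<in> H" "B \<in> H" for A B
    using that generate_mult by (simp add: H_def)
  have one: "mat 1 \<in> H"
    using generate.one [of ESL] by (simp add: H_def)
  have gens: "refl_to 1 2 \<in> H" "minus_D\<^sub>0 \<in> H" "F\<^sub>U \<in> H"
    by (auto simp: H_def I\<^sub>1\<^sub>2_eq intro: generate.incl)
  have reflect1: "refl_to (1 - i) (1 - j) \<in> H" if "refl_to i j \<in> H" for i j
    using refl_to_conj [of "\<lambda>r. 1 - r" i j] that gens(2) mult
    by (simp add: minus_D\<^sub>0_eq)
  have reflect0: "refl_to (- i) (- j) \<in> H" if "refl_to i j \<in> H" for i j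
    using refl_to_conj [of "\<lambda>r. - r" i j] that gens(3) mult
    by (simp add: F\<^sub>U_eq)
  \<comment> \<open>The two reflections of the indices compose to the rotation
    \<open>r \<mapsto> r + 1\<close>.\<close>
  have shift: "refl_to (i + 1) (j + 1) \<in> H" if "refl_to i j \<in> H" for i j
    using reflect1 [OF reflect0 [OF that]] by (simp add: add.commute)
  have refl_Suc: "refl_to i (i + 1) \<in> H" for i
    using gens(1) shift [of 1 2] shift [of 2 3] shift [of 3 4] shift [of 4 5]
    by (cases rule: disjE [OF exhaust_5 [of i]]) auto
  \<comment> \<open>Negation reverses the direction around the cycle: \<open>- i - 1\<close> and
    \<open>- i\<close> become \<open>i + 1\<close> and \<open>i\<close>.\<close>
  have refl_pred: "refl_to (i + 1) i \<in> H" for i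
    using reflect0 [OF refl_Suc [of "- i - 1"]] by (simp add: add.commute)
  \<comment> \<open>Offsets wrap around: \<open>i + 4\<close> is followed by \<open>i\<close>, which
    closes the cycle that \<open>transv_word\<close> needs.\<close>
  have five: "(5::5) = 0" by simp
  have refl_4: "refl_to i (i + 4) \<in> H" "refl_to (i + 4) (i + 3) \<in> H" for i
    using refl_pred [of "i + 4"] refl_pred [of "i + 3"] by (simp_all add: add.assoc five)
  have refl_1_2: "refl_to (i + 1) (i + 2) \<in> H" "refl_to (i + 2) (i + 3) \<in> H" for i
    using refl_Suc [of "i + 1"] refl_Suc [of "i + 2"] by (simp_all add: add.assoc)
  have transv_2: "transv i (i + 2) 1 \<in> H" for i
  proof -
    have "transv i (i + 2) 1 ** mat 1 \<in> H"
      by (subst transv_word [of i "i + 1" "i + 2" "i + 3" "i + 4"])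
        (intro mult refl_Suc refl_4 refl_1_2 one | simp)+
    then show ?thesis by simp
  qed
  have trans: "transv i k 1 \<in> H"
    if "transv i j 1 \<in> H" "refl_to j k \<in> H" "i \<noteq> j" "j \<noteq> k" "i \<noteq> k" for i j k
    using mult [OF that(2) mult [OF that(1) mult [OF that(2) mult [OF that(1) one]]]]
      transv_trans [OF that(3-5), of "mat 1"] by simp
  \<comment> \<open>From offset 2, steps along the cycle reach offsets 3 and 4 forwards and offset 1
    backwards: all nonzero offsets modulo 5.\<close>
  have transv_3: "transv i (i + 3) 1 \<in> H" for i
    using trans [of i "i + 2" "i + 3"] transv_2 [of i] refl_1_2 [of i] by simp
  have transv_4: "transv i (i + 4) 1 \<in> H" for i
    using trans [of i "i + 3" "i + 4"] transv_3 [of i] refl_Suc [of "i + 3"]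
    by (simp add: add.assoc)
  have transv_1: "transv i (i + 1) 1 \<in> H" for i
    using trans [of i "i + 2" "i + 1"] transv_2 [of i] refl_pred [of "i + 1"]
    by (simp add: add.assoc)
  have transv: "transv i j 1 \<in> H" if "i \<noteq> j" for i j
    using exhaust_5 [of "j - i"] transv_1 [of i] transv_2 [of i] transv_3 [of i] transv_4 [of i] that
    by (auto simp: diff_eq_eq add.commute)
  have negate: "negate i \<in> H" for i
    using negate_eq [of i "i + 1" "mat 1"] mult [OF refl_Suc [of i] transv_1 [of i]] by simp
  have transv_nat: "transv i j (int n) \<in> H" if "i \<noteq> j" for i j n
  proof (induction n)
    case 0
    have "transv i j 0 = mat 1"
      by (simp add: transv_def mat_def vec_eq_iff)
    with one show ?case by simp
  next
    case (Suc n)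
    have "transv i j (int (Suc n)) ** mat 1 = transv i j 1 ** (transv i j (int n) ** mat 1)"
      using that by (simp add: transv_mult vec_eq_iff distrib_right del: matrix_mul_rid)
    with Suc mult [OF transv [OF that]] show ?case by simp
  qed
  have transv_inv: "transv i j (-c) ** (transv i j c ** A) = A" if "i \<noteq> j" for i j :: 5 and c A
    using that by (simp add: transv_mult vec_eq_iff)
  have transv_int: "transv i j c \<in> H" if "i \<noteq> j" for i j c
  proof (cases c rule: int_cases2)
    case (nonneg n)
    with transv_nat [OF that] show ?thesis by simp
  next
    case (nonpos n)
    \<comment> \<open>Conjugation by \<open>negate i\<close> flips the sign of the multiple added to
      row \<open>i\<close>.\<close>
    have "transv i j (- int n) ** mat 1 = negate i ** (transv i j (int n) ** (negate i ** mat 1))"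
      using that by (simp add: transv_mult negate_mult vec_eq_iff del: matrix_mul_rid)
    with nonpos mult [OF negate] mult [OF transv_nat [OF that] negate] show ?thesis by simp
  qed
  have "A \<in> H" if "det A = 1 \<or> det A = -1" for A
    using that
  proof (induction rule: unimodular_row_induct)
    case id show ?case by (fact one)
  next
    case (add A i j c)
    \<comment> \<open>Membership passes back from the reduced matrix, because the inverse row
      operation also lies in \<open>H\<close>.\<close>
    then have "transv i j (- c) ** (transv i j c ** A) \<in> H"
      using mult [OF transv_int] by simp
    then show ?case
      by (simp only: transv_inv [OF add.hyps])
  next
    case (neg A i)
    have "negate i ** (negate i ** A) = A"
      by (simp add: negate_mult vec_eq_iff)
    with mult [OF negate neg.IH, of i] show ?case by simp
  qed
  moreover have "H \<subseteq> carrier ESL"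
    unfolding H_def
  proof (rule group.generate_incl [OF group_ESL])
    show "{I\<^sub>1\<^sub>2, minus_D\<^sub>0, F\<^sub>U} \<subseteq> carrier ESL"
    proof -
      \<comment> \<open>Each generator is an involution, so its determinant squares to 1.\<close>
      have "det A = 1 \<or> det A = -1" if "A ** A = mat 1" for A :: "int^5^5"
        using arg_cong [OF that, of det] by (simp add: det_mul square_eq_1_iff)
      moreover have "I\<^sub>1\<^sub>2 ** (I\<^sub>1\<^sub>2 ** mat 1) = mat 1"
        by (simp add: I\<^sub>1\<^sub>2_eq refl_to_mult vec_eq_iff del: matrix_mul_rid)
      moreover have "minus_D\<^sub>0 ** minus_D\<^sub>0 = mat 1"
        by (subst (1) minus_D\<^sub>0_eq, subst perm_mult) (auto simp: minus_D\<^sub>0_eq vec_eq_iff mat_def)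
      moreover have "F\<^sub>U ** F\<^sub>U = mat 1"
        by (subst (1) F\<^sub>U_eq, subst perm_mult) (auto simp: F\<^sub>U_eq vec_eq_iff mat_def)
      ultimately show ?thesis by auto
    qed
  qed
  ultimately show ?thesis
    by (auto simp: H_def [symmetric])
qed

end
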